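(* Let $n\geq 2$ and $k_1,\dots,k_n\geq 3$ be integers such that the torus $T_{k_1,\ldots,k_n}$ is bipartite. Then $fmp(T_{k_1,\ldots ,k_n})=2n$ and $fsmp(T_{k_1,\ldots ,k_n})=1$.
   Context: The $n$-dimensional torus $T_{k_1,\ldots,k_n}$ (with $k_i\geq 3$) has vertex set $\{(x_1,\dots,x_n):0\leq x_i\leq k_i-1\}$, two vertices being adjacent iff they differ in exactly one coordinate $i$ and there $a_i-b_i\equiv\pm1\pmod{k_i}$. A fractional perfect matching of $G$ is $g:E(G)\to[0,1]$ with $\sum_{e\ni v}g(e)=1$ for all $v$. $fmp(G)$ (resp. $fsmp(G)$) is the minimum size of a set $F\subseteq E(G)$ (resp. $F\subseteq V(G)\cup E(G)$) whose deletion (vertices with incident edges, and edges) leaves a graph with no fractional perfect matching. *)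

theory Defs
  imports Complex_Main "HOL-Library.FuncSet" "HOL-Library.Extended_Nat" "HOL-Number_Theory.Cong"
begin

record 'a ugraph =
  verts :: "'a set"
  edges :: "'a set set"

definition bipartite :: "'a ugraph \<Rightarrow> bool" where
  "bipartite G \<longleftrightarrow>
     (\<exists>A B. A \<union> B = verts G \<and> A \<inter> B = {} \<and>
            (\<forall>e\<in>edges G. \<exists>a\<in>A. \<exists>b\<in>B. e = {a, b}))"

definition fractional_perfect_matching :: "'a ugraph \<Rightarrow> ('a set \<Rightarrow> real) \<Rightarrow> bool" where
  "fractional_perfect_matching G g \<longleftrightarrow>
     (\<forall>e\<in>edges G. 0 \<le> g e \<and> g e \<le> 1) \<and>
     (\<forall>v\<in>verts G. (\<Sum>e\<in>{e \<in> edges G. v \<in> e}. g e) = 1)"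

definition delete :: "'a ugraph \<Rightarrow> 'a set \<Rightarrow> 'a set set \<Rightarrow> 'a ugraph" where
  "delete G X F =
     \<lparr>verts = verts G - X, edges = {e \<in> edges G. e \<notin> F \<and> e \<inter> X = {}}\<rparr>"

(* The two preclusion numbers take values in enat so that the minimum over an empty family
   is \<infinity>. "finite F" only matters for infinite graphs, where card F would be 0. *)

definition fmp :: "'a ugraph \<Rightarrow> enat" where
  "fmp G =
     (INF F\<in>{F. F \<subseteq> edges G \<and> finite F \<and>
                 (\<nexists>g. fractional_perfect_matching (delete G {} F) g)}. enat (card F))"

(* A subset of V(G) \<union> E(G) is a subset of the disjoint sum: Inl tags its vertices, Inr its edges. *)

definition fsmp :: "'a ugraph \<Rightarrow> enat" where
  "fsmp G =
     (INF F\<in>{F. F \<subseteq> verts G <+> edges G \<and> finite F \<and>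
                 (\<nexists>g. fractional_perfect_matching (delete G (Inl -` F) (Inr -` F)) g)}.
        enat (card F))"

(* Vertices are n-tuples, encoded as functions on {1..n} (undefined elsewhere). *)

definition torus_verts :: "nat \<Rightarrow> (nat \<Rightarrow> nat) \<Rightarrow> (nat \<Rightarrow> nat) set" where
  "torus_verts n k = (\<Pi>\<^sub>E i\<in>{1..n}. {0..k i - 1})"

definition torus_adj :: "nat \<Rightarrow> (nat \<Rightarrow> nat) \<Rightarrow> (nat \<Rightarrow> nat) \<Rightarrow> (nat \<Rightarrow> nat) \<Rightarrow> bool" where
  "torus_adj n k a b \<longleftrightarrow>
     (\<exists>i\<in>{1..n}. a i \<noteq> b i \<and> (\<forall>j\<in>{1..n} - {i}. a j = b j) \<and>
        ([int (a i) - int (b i) = 1] (mod int (k i)) \<or>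
         [int (a i) - int (b i) = - 1] (mod int (k i))))"

definition torus :: "nat \<Rightarrow> (nat \<Rightarrow> nat) \<Rightarrow> (nat \<Rightarrow> nat) ugraph" where
  "torus n k =
     \<lparr>verts = torus_verts n k,
      edges = {{a, b} | a b. a \<in> torus_verts n k \<and> b \<in> torus_verts n k \<and> torus_adj n k a b}\<rparr>"

end

theory Submission imports Defs begin

text \<open>
  In a bipartite torus every \<open>k i\<close> is even, because the cycle in direction \<open>i\<close> has length \<open>k i\<close>.
  The edges in direction \<open>i\<close> therefore split into two perfect matchings, according to the parity of
  the \<open>i\<close>-th coordinate of their initial vertex, and the torus is a disjoint union of \<open>2 * n\<close>
  perfect matchings.  Deleting fewer than \<open>2 * n\<close> edges leaves one of them intact, while deleting the
  \<open>2 * n\<close> edges at a vertex isolates it.  In a bipartite graph a fractional perfect matching forces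
  both parts to have the same size, so deleting a single vertex destroys all of them.
\<close>

section \<open>Fractional perfect matchings of bipartite graphs\<close>

text \<open>Double counting: every edge has exactly one end in each part, so adding up the vertex
  conditions over either part gives the total weight of all edges.\<close>

lemma fractional_perfect_matching_card_parts:
  fixes G :: "'a ugraph"
  assumes fin: "finite (verts G)"
    and AB: "A \<union> B = verts G" "A \<inter> B = {}"
    and edges: "\<And>e. e \<in> edges G \<Longrightarrow> \<exists>a\<in>A. \<exists>b\<in>B. e = {a, b}"
    and g: "fractional_perfect_matching G g"
  shows "card A = card B"
proof -
  have finAB: "finite A" "finite B"
    using fin AB(1) by (auto intro: finite_subset)
  have "edges G \<subseteq> Pow (verts G)"
    using edges AB(1) by blast
  then have finE: "finite (edges G)"
    using fin by (meson finite_Pow_iff finite_subset)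
  have count: "real (card X) = sum g (edges G)"
    if X: "finite X" "X \<subseteq> verts G" "\<And>e. e \<in> edges G \<Longrightarrow> \<exists>x. {v \<in> X. v \<in> e} = {x}" for X
  proof -
    have "real (card X) = (\<Sum>v\<in>X. \<Sum>e | e \<in> edges G \<and> v \<in> e. g e)"
      using g X(2) by (simp add: fractional_perfect_matching_def subset_iff)
    also have "\<dots> = (\<Sum>e\<in>edges G. \<Sum>v | v \<in> X \<and> v \<in> e. g e)"
      by (rule sum.swap_restrict[OF X(1) finE])
    also have "\<dots> = sum g (edges G)"
    proof (rule sum.cong[OF refl])
      fix e assume "e \<in> edges G"
      then obtain x where "{v \<in> X. v \<in> e} = {x}" using X(3) by blast
      then show "(\<Sum>v | v \<in> X \<and> v \<in> e. g e) = g e" by simp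
    qed
    finally show ?thesis .
  qed
  have "\<exists>x. {v \<in> A. v \<in> e} = {x}" "\<exists>x. {v \<in> B. v \<in> e} = {x}" if "e \<in> edges G" for e
  proof -
    obtain a b where "a \<in> A" "b \<in> B" "e = {a, b}" using edges[OF \<open>e \<in> edges G\<close>] by blast
    then have "{v \<in> A. v \<in> e} = {a}" "{v \<in> B. v \<in> e} = {b}" using AB(2) by auto
    then show "\<exists>x. {v \<in> A. v \<in> e} = {x}" "\<exists>x. {v \<in> B. v \<in> e} = {x}" by blast+
  qed
  then have "real (card A) = real (card B)"
    using count[OF finAB(1)] count[OF finAB(2)] AB(1) by (metis Un_upper1 Un_upper2)
  then show ?thesis by simp
qed

text \<open>The matching \<open>g\<close> makes the two parts equally large, and removing
  \<open>v\<close> shrinks exactly one of them.\<close>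

lemma bipartite_delete_vertex_no_fractional_perfect_matching:
  assumes fin: "finite (verts G)"
    and bip: "bipartite G"
    and g: "fractional_perfect_matching G g"
    and v: "v \<in> verts G"
  shows "\<not> fractional_perfect_matching (delete G {v} {}) h"
proof
  assume h: "fractional_perfect_matching (delete G {v} {}) h"
  obtain A B where AB: "A \<union> B = verts G" "A \<inter> B = {}"
    and edges: "\<forall>e\<in>edges G. \<exists>a\<in>A. \<exists>b\<in>B. e = {a, b}"
    using bip unfolding bipartite_def by (elim exE conjE)
  have "card A = card B"
    by (rule fractional_perfect_matching_card_parts[OF fin AB bspec[OF edges] g])
  moreover have "card (A - {v}) = card (B - {v})"
  proof (rule fractional_perfect_matching_card_parts[OF _ _ _ _ h])
    fix e assume "e \<in> edges (delete G {v} {})"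
    then have e: "e \<in> edges G" "v \<notin> e" by (auto simp: delete_def)
    then obtain a b where "a \<in> A" "b \<in> B" "e = {a, b}" using bspec[OF edges e(1)] by blast
    then show "\<exists>a\<in>A - {v}. \<exists>b\<in>B - {v}. e = {a, b}" using e(2) by blast
  qed (use fin AB in \<open>auto simp: delete_def\<close>)
  moreover have "finite A" "finite B"
    using fin AB(1) by (auto intro: finite_subset)
  moreover have "v \<in> A \<and> v \<notin> B \<or> v \<notin> A \<and> v \<in> B"
    using v AB by blast
  ultimately show False
    by (metis Diff_empty Diff_insert0 card_Diff1_less less_irrefl)
qed

lemma delete_empty [simp]: "delete G {} {} = G"
  by (simp add: delete_def)

lemma fsmp_bipartite:
  fixes G :: "'a ugraph"
  assumes fin: "finite (verts G)"
    and bip: "bipartite G"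
    and g: "fractional_perfect_matching G g"
    and v: "v \<in> verts G"
  shows "fsmp G = 1"
proof (rule antisym)
  \<comment> \<open>Upper bound: delete the vertex \<open>v\<close> alone. For the lower bound, the
    empty set is excluded because \<open>g\<close> survives.\<close>
  have "Inl -` {Inl v :: 'a + 'a set} = {v}" "Inr -` {Inl v :: 'a + 'a set} = {}" by auto
  then have "{Inl v} \<in> {F. F \<subseteq> verts G <+> edges G \<and> finite F \<and>
      (\<nexists>g. fractional_perfect_matching (delete G (Inl -` F) (Inr -` F)) g)}"
    using bipartite_delete_vertex_no_fractional_perfect_matching[OF assms] v by auto
  then have "fsmp G \<le> enat (card {Inl v :: 'a + 'a set})"
    unfolding fsmp_def by (rule INF_lower)
  then show "fsmp G \<le> 1" by (simp add: one_enat_def)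
  show "1 \<le> fsmp G"
    unfolding fsmp_def
  proof (rule INF_greatest)
    fix F :: "('a + 'a set) set"
    assume F: "F \<in> {F. F \<subseteq> verts G <+> edges G \<and> finite F \<and>
                 (\<nexists>g. fractional_perfect_matching (delete G (Inl -` F) (Inr -` F)) g)}"
    then have "F \<noteq> {}" using g by auto
    then have "card F \<ge> 1" using F by (simp add: Suc_leI card_gt_0_iff)
    then show "1 \<le> enat (card F)" by (simp add: one_enat_def)
  qed
qed

section \<open>Graphs that split into perfect matchings\<close>

text \<open>An edge colouring, where \<open>mate c v\<close> is the other end of the edge of colour
  \<open>c\<close> at \<open>v\<close>. The involution law makes each colour class a perfect
  matching; injectivity in the colour makes distinct classes disjoint.\<close>

locale one_factorization =
  fixes G :: "'a ugraph" and C :: "'c set" and mate :: "'c \<Rightarrow> 'a \<Rightarrow> 'a"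
  assumes finite_colours: "finite C"
    and edges_eq: "edges G = {{v, mate c v} | v c. v \<in> verts G \<and> c \<in> C}"
    and mate_mate: "\<And>c v. c \<in> C \<Longrightarrow> v \<in> verts G \<Longrightarrow> mate c (mate c v) = v"
    and inj_mate: "\<And>v. v \<in> verts G \<Longrightarrow> inj_on (\<lambda>c. mate c v) C"
begin

definition factor :: "'c \<Rightarrow> 'a set set" where
  "factor c = (\<lambda>v. {v, mate c v}) ` verts G"

lemma factor_at_vertex:
  assumes c: "c \<in> C" and v: "v \<in> verts G"
  shows "{e \<in> factor c. v \<in> e} = {{v, mate c v}}"
  using mate_mate[OF c] v by (auto simp: factor_def)

lemma edges_at_vertex:
  "{e \<in> edges G. v \<in> e} \<subseteq> (\<lambda>c. {v, mate c v}) ` C"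
proof
  fix e assume "e \<in> {e \<in> edges G. v \<in> e}"
  then obtain u c where u: "u \<in> verts G" and c: "c \<in> C" and e: "e = {u, mate c u}" "v \<in> e"
    by (auto simp: edges_eq)
  \<comment> \<open>If \<open>v\<close> is the mate of \<open>u\<close>, then \<open>u\<close> is
    the mate of \<open>v\<close> in the same colour.\<close>
  have "e = {v, mate c v}"
    using e mate_mate[OF c u] by auto
  then show "e \<in> (\<lambda>c. {v, mate c v}) ` C"
    using c by blast
qed

text \<open>An edge in two classes would give one of its ends the same mate in both colours.
  Consequently one deleted edge spoils only one class.\<close>

lemma factor_disjoint:
  assumes e: "e \<in> factor c" "e \<in> factor d" and cd: "c \<in> C" "d \<in> C"
  shows "c = d"
proof -
  obtain v where v: "v \<in> verts G" "e = {v, mate c v}"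
    using e(1) by (auto simp: factor_def)
  have "e \<in> {e \<in> factor d. v \<in> e}"
    using e(2) v(2) by simp
  then have "e = {v, mate d v}"
    by (simp add: factor_at_vertex[OF cd(2) v(1)])
  then have "mate c v = mate d v"
    using v(2) by (auto simp: doubleton_eq_iff)
  then show ?thesis
    using inj_mate[OF v(1)] cd by (auto dest: inj_onD)
qed

text \<open>The indicator of a class has exactly one edge of weight 1 at each vertex. With
  \<open>F\<close> empty this yields a matching of \<open>G\<close>; read contrapositively, a set
  \<open>F\<close> that destroys all matchings meets every class.\<close>

lemma fractional_perfect_matching_factor:
  assumes c: "c \<in> C" and F: "factor c \<inter> F = {}"
  shows "fractional_perfect_matching (delete G {} F) (\<lambda>e. of_bool (e \<in> factor c))"
  unfolding fractional_perfect_matching_def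
proof (intro conjI ballI)
  fix v assume "v \<in> verts (delete G {} F)"
  then have v: "v \<in> verts G" by (simp add: delete_def)
  let ?S = "{e \<in> edges (delete G {} F). v \<in> e}"
  have "factor c \<subseteq> edges G"
    using c by (auto simp: factor_def edges_eq)
  then have S: "{e \<in> ?S. e \<in> factor c} = {{v, mate c v}}"
    using factor_at_vertex[OF c v] F by (auto simp: delete_def)
  have "?S \<subseteq> (\<lambda>d. {v, mate d v}) ` C"
    using edges_at_vertex by (auto simp: delete_def)
  then have "finite ?S"
    using finite_colours finite_surj by blast
  then have "(\<Sum>e\<in>?S. of_bool (e \<in> factor c)) = real (card {e \<in> ?S. e \<in> factor c})"
    by (simp add: of_bool_def sum.If_cases Int_def)
  then show "(\<Sum>e\<in>?S. of_bool (e \<in> factor c)) = (1::real)"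
    unfolding S by simp
qed auto

lemma fmp_eq_card_colours:
  assumes v: "v \<in> verts G"
  shows "fmp G = enat (card C)"
proof (rule antisym)
  \<comment> \<open>Deleting all edges at \<open>v\<close> keeps \<open>v\<close> as a vertex, whose
    sum is then empty and equals 0 instead of 1.\<close>
  let ?F = "{e \<in> edges G. v \<in> e}"
  note sub = edges_at_vertex[of v]
  have no_edges: "{e \<in> edges (delete G {} ?F). v \<in> e} = {}"
    by (auto simp: delete_def)
  have "\<not> fractional_perfect_matching (delete G {} ?F) g" for g
  proof
    assume "fractional_perfect_matching (delete G {} ?F) g"
    then have "(\<Sum>e\<in>{e \<in> edges (delete G {} ?F). v \<in> e}. g e) = 1"
      using v unfolding fractional_perfect_matching_def by (auto simp: delete_def)
    then show False unfolding no_edges by simp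
  qed
  moreover have "finite ?F"
    using sub finite_colours finite_surj by blast
  ultimately have "fmp G \<le> enat (card ?F)"
    unfolding fmp_def by (intro INF_lower) auto
  also have "card ?F \<le> card C"
    using sub finite_colours by (rule surj_card_le[rotated])
  finally show "fmp G \<le> enat (card C)" by simp
next
  show "enat (card C) \<le> fmp G"
    unfolding fmp_def
  proof (rule INF_greatest)
    fix F
    assume F: "F \<in> {F. F \<subseteq> edges G \<and> finite F \<and>
                 (\<nexists>g. fractional_perfect_matching (delete G {} F) g)}"
    \<comment> \<open>Choosing one edge of \<open>F\<close> in each class gives an injection from
      the colours into \<open>F\<close>, as the classes are disjoint.\<close>
    then have "\<forall>c\<in>C. \<exists>e. e \<in> factor c \<inter> F"
      using fractional_perfect_matching_factor by blast
    then obtain f where f: "\<And>c. c \<in> C \<Longrightarrow> f c \<in> factor c \<inter> F"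
      by metis
    have "inj_on f C"
      using f factor_disjoint by (metis IntD1 inj_onI)
    then have "card C \<le> card F"
      using f F by (intro card_inj_on_le[of f]) auto
    then show "enat (card C) \<le> enat (card F)" by simp
  qed
qed

end

section \<open>Neighbours modulo \<open>k\<close> as natural numbers\<close>

lemma cong_int_nat_iff:
  fixes x y k :: nat
  assumes "x < k"
  shows "[int x = int y] (mod int k) \<longleftrightarrow> x = y mod k"
  using assms unfolding cong_int_iff by (simp add: cong_def)

lemma cong_diff_1_iff:
  fixes x y k :: nat
  assumes "x < k"
  shows "[int x - int y = 1] (mod int k) \<longleftrightarrow> x = (y + 1) mod k"
proof -
  have "[int x - int y = 1] (mod int k) \<longleftrightarrow> [int x = int (y + 1)] (mod int k)"
    by (simp add: cong_iff_dvd_diff algebra_simps)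
  then show ?thesis
    by (simp only: cong_int_nat_iff[OF assms])
qed

lemma cong_diff_minus_1_iff:
  fixes x y k :: nat
  assumes "x < k"
  shows "[int x - int y = - 1] (mod int k) \<longleftrightarrow> x = (y + (k - 1)) mod k"
proof -
  \<comment> \<open>Adding \<open>k - 1\<close> replaces subtracting 1, which would be truncated at
    \<open>y = 0\<close>; the price is a shift by one full period.\<close>
  have "int x - int y - (- 1) = int x - int (y + (k - 1)) + int k"
    using assms by simp
  then have "int k dvd int x - int y - (- 1) \<longleftrightarrow> int k dvd int x - int (y + (k - 1))"
    by (simp only: dvd_add_left_iff[OF dvd_refl])
  then have "[int x - int y = - 1] (mod int k) \<longleftrightarrow> [int x = int (y + (k - 1))] (mod int k)"
    by (simp only: cong_iff_dvd_diff)
  then show ?thesis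
    by (simp only: cong_int_nat_iff[OF assms])
qed

section \<open>The torus and the colouring of its edges\<close>

text \<open>Positivity matters: for \<open>k i = 0\<close> the truncated bound
  \<open>k i - 1\<close> would still admit the coordinate 0.\<close>

lemma torus_verts_iff:
  assumes "\<forall>i\<in>{1..n}. k i > 0"
  shows "v \<in> torus_verts n k \<longleftrightarrow> v \<in> extensional {1..n} \<and> (\<forall>i\<in>{1..n}. v i < k i)"
proof -
  have "v i \<in> {0..k i - 1} \<longleftrightarrow> v i < k i" if "i \<in> {1..n}" for i
    using assms that by fastforce
  then show ?thesis
    unfolding torus_verts_def PiE_iff by auto
qed

lemma finite_torus_verts: "finite (torus_verts n k)"
  unfolding torus_verts_def by (intro finite_PiE) auto

text \<open>The colour \<open>(i, p)\<close> consists of a direction and the parity at which a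
  forward edge starts, \<open>True\<close> meaning even. A vertex of that parity steps forward, any
  other steps back.\<close>

definition torus_mate :: "(nat \<Rightarrow> nat) \<Rightarrow> nat \<times> bool \<Rightarrow> (nat \<Rightarrow> nat) \<Rightarrow> nat \<Rightarrow> nat" where
  "torus_mate k = (\<lambda>(i, p) v.
     v(i := (if even (v i) = p then (v i + 1) mod k i else (v i + (k i - 1)) mod k i)))"

lemma succ_mod:
  fixes x k :: nat
  assumes "x < k"
  shows "(x + 1) mod k = (if x + 1 = k then 0 else x + 1)"
  using assms by auto

lemma pred_mod:
  fixes x k :: nat
  assumes "x < k"
  shows "(x + (k - 1)) mod k = (if x = 0 then k - 1 else x - 1)"
  using assms by (auto simp: mod_if)

lemma pred_mod_succ_mod:
  fixes x k :: nat
  assumes "x < k"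
  shows "((x + 1) mod k + (k - 1)) mod k = x"
proof -
  have "((x + 1) mod k + (k - 1)) mod k = (x + 1 + (k - 1)) mod k"
    by (rule mod_add_left_eq)
  also have "x + 1 + (k - 1) = x + k"
    using assms by simp
  finally show ?thesis
    using assms by simp
qed

lemma succ_mod_pred_mod:
  fixes x k :: nat
  assumes "x < k"
  shows "((x + (k - 1)) mod k + 1) mod k = x"
proof -
  have "((x + (k - 1)) mod k + 1) mod k = (x + (k - 1) + 1) mod k"
    by (rule mod_add_left_eq)
  also have "x + (k - 1) + 1 = x + k"
    using assms by simp
  finally show ?thesis
    using assms by simp
qed

text \<open>The bound 3 is sharp for the last inequality: for \<open>k = 2\<close> successor and
  predecessor coincide.\<close>

lemma succ_pred_mod_neq:
  fixes x k :: nat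
  assumes "3 \<le> k" "x < k"
  shows "(x + 1) mod k \<noteq> x" "(x + (k - 1)) mod k \<noteq> x" "(x + 1) mod k \<noteq> (x + (k - 1)) mod k"
  unfolding succ_mod[OF assms(2)] pred_mod[OF assms(2)] using assms by auto

lemma torus_mate_in_verts:
  assumes "\<forall>i\<in>{1..n}. k i > 0" "v \<in> torus_verts n k" "i \<in> {1..n}"
  shows "torus_mate k (i, p) v \<in> torus_verts n k"
proof -
  have v: "v \<in> extensional {1..n}" "\<forall>j\<in>{1..n}. v j < k j"
    using assms(2) unfolding torus_verts_iff[OF assms(1)] by blast+
  have "torus_mate k (i, p) v \<in> extensional {1..n}"
    using v(1) assms(3) by (auto simp: torus_mate_def extensional_def)
  moreover have "\<forall>j\<in>{1..n}. torus_mate k (i, p) v j < k j"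
    using v(2) assms(1) by (simp add: torus_mate_def)
  ultimately show ?thesis
    unfolding torus_verts_iff[OF assms(1)] by blast
qed

text \<open>For even \<open>k i\<close> each step flips the parity of the coordinate, also on
  wrapping around, so the second step goes in the opposite direction.\<close>

lemma torus_mate_mate:
  assumes "even (k i)" "v i < k i"
  shows "torus_mate k (i, p) (torus_mate k (i, p) v) = v"
proof -
  have k: "k i \<ge> 1" using assms by simp
  have "even ((v i + 1) mod k i) \<longleftrightarrow> odd (v i)" "even ((v i + (k i - 1)) mod k i) \<longleftrightarrow> odd (v i)"
    using assms k by (simp_all add: dvd_mod_iff)
  then show ?thesis
    unfolding torus_mate_def using pred_mod_succ_mod[OF assms(2)] succ_mod_pred_mod[OF assms(2)] by auto
qed

text \<open>Mates in different directions differ from \<open>v\<close> in different coordinates; in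
  one direction the two parities give the successor and the predecessor, which are distinct.\<close>

lemma inj_on_torus_mate:
  assumes k: "\<And>i. i \<in> {1..n} \<Longrightarrow> k i \<ge> 3" and v: "v \<in> torus_verts n k"
  shows "inj_on (\<lambda>c. torus_mate k c v) ({1..n} \<times> UNIV)"
proof (rule inj_onI, clarify)
  fix i p j q
  assume i: "i \<in> {1..n}" and j: "j \<in> {1..n}"
    and eq: "torus_mate k (i, p) v = torus_mate k (j, q) v"
  have k0: "\<forall>i\<in>{1..n}. k i > 0"
    using k by force
  have lt: "v i < k i" using v i unfolding torus_verts_iff[OF k0] by blast
  note neq = succ_pred_mod_neq[OF k[OF i] lt]
  have at_i: "torus_mate k (i, p) v i = torus_mate k (j, q) v i"
    by (simp only: eq)
  have "i = j"
  proof (rule ccontr)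
    assume "i \<noteq> j"
    then show False using at_i neq by (auto simp: torus_mate_def split: if_splits)
  qed
  moreover from this have "p = q"
    using at_i neq by (auto simp: torus_mate_def split: if_splits)
  ultimately show "i = j \<and> p = q" by simp
qed

lemma torus_adj_iff_mate:
  assumes k: "\<And>i. i \<in> {1..n} \<Longrightarrow> k i \<ge> 3"
    and v: "v \<in> torus_verts n k" and w: "w \<in> torus_verts n k"
  shows "torus_adj n k w v \<longleftrightarrow> (\<exists>c\<in>{1..n} \<times> UNIV. w = torus_mate k c v)"
proof -
  have k0: "\<forall>i\<in>{1..n}. k i > 0"
    using k by force
  have lt: "v i < k i" "w i < k i" if "i \<in> {1..n}" for i
    using v w that unfolding torus_verts_iff[OF k0] by blast+
  have ext: "v \<in> extensional {1..n}" "w \<in> extensional {1..n}"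
    using v w unfolding torus_verts_def PiE_iff by blast+
  have step: "w i \<noteq> v i \<and> (\<forall>j\<in>{1..n} - {i}. w j = v j) \<and>
      ([int (w i) - int (v i) = 1] (mod int (k i)) \<or>
       [int (w i) - int (v i) = - 1] (mod int (k i))) \<longleftrightarrow> (\<exists>p. w = torus_mate k (i, p) v)"
    (is "?L \<longleftrightarrow> ?R") if i: "i \<in> {1..n}" for i
  proof
    assume L: ?L
    have "w j = v j" if "j \<noteq> i" for j
      using L ext that by (cases "j \<in> {1..n}") (auto simp: extensional_def)
    then have "w = v(i := w i)" by auto
    moreover have "w i = (v i + 1) mod k i \<or> w i = (v i + (k i - 1)) mod k i"
      using L lt[OF i] by (simp only: cong_diff_1_iff cong_diff_minus_1_iff)
    ultimately have "w = v(i := (v i + 1) mod k i) \<or> w = v(i := (v i + (k i - 1)) mod k i)"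
      by metis
    \<comment> \<open>The parity equal to that of \<open>v i\<close> selects the successor, the
      other one the predecessor.\<close>
    then have "w = torus_mate k (i, even (v i)) v \<or> w = torus_mate k (i, odd (v i)) v"
      by (auto simp: torus_mate_def)
    then show ?R by blast
  next
    assume ?R
    then obtain p where p: "w = torus_mate k (i, p) v" by blast
    have "w i = (v i + 1) mod k i \<or> w i = (v i + (k i - 1)) mod k i"
      unfolding p by (simp add: torus_mate_def)
    moreover have "\<forall>j\<in>{1..n} - {i}. w j = v j"
      unfolding p by (simp add: torus_mate_def)
    ultimately show ?L
      using succ_pred_mod_neq[OF k[OF i] lt(1)[OF i]]
      unfolding cong_diff_1_iff[OF lt(2)[OF i]] cong_diff_minus_1_iff[OF lt(2)[OF i]] by metis
  qed
  have "torus_adj n k w v \<longleftrightarrow> (\<exists>i\<in>{1..n}. \<exists>p. w = torus_mate k (i, p) v)"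
    unfolding torus_adj_def by (rule bex_cong[OF refl step])
  then show ?thesis by auto
qed

lemma torus_edges_eq:
  assumes k: "\<And>i. i \<in> {1..n} \<Longrightarrow> k i \<ge> 3"
  shows "edges (torus n k) =
    {{v, torus_mate k c v} | v c. v \<in> torus_verts n k \<and> c \<in> {1..n} \<times> UNIV}"
proof -
  have k0: "\<forall>i\<in>{1..n}. k i > 0"
    using k by force
  show ?thesis
  proof (intro equalityI subsetI)
    fix e assume "e \<in> edges (torus n k)"
    then obtain w v where e: "e = {w, v}"
      and V: "w \<in> torus_verts n k" "v \<in> torus_verts n k" and adj: "torus_adj n k w v"
      unfolding torus_def by auto
    then obtain c where "c \<in> {1..n} \<times> UNIV" "w = torus_mate k c v"
      using torus_adj_iff_mate[OF k V(2,1)] by blast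
    then show "e \<in> {{v, torus_mate k c v} | v c. v \<in> torus_verts n k \<and> c \<in> {1..n} \<times> UNIV}"
      using e V(2) by blast
  next
    fix e
    assume "e \<in> {{v, torus_mate k c v} | v c. v \<in> torus_verts n k \<and> c \<in> {1..n} \<times> UNIV}"
    then obtain v i p where e: "e = {torus_mate k (i, p) v, v}"
      and v: "v \<in> torus_verts n k" and i: "i \<in> {1..n}"
      by blast
    have w: "torus_mate k (i, p) v \<in> torus_verts n k"
      using torus_mate_in_verts[OF k0 v i] .
    then have "torus_adj n k (torus_mate k (i, p) v) v"
      using torus_adj_iff_mate[OF k v w] i by blast
    then show "e \<in> edges (torus n k)"
      unfolding torus_def using e v w by auto
  qed
qed

text \<open>The cycle in direction \<open>i\<close> alternates between the two parts and closes up
  after \<open>k i\<close> steps.\<close>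

lemma bipartite_torus_even:
  assumes k: "\<And>i. i \<in> {1..n} \<Longrightarrow> k i \<ge> 3"
    and bip: "bipartite (torus n k)" and i: "i \<in> {1..n}"
  shows "even (k i)"
proof -
  obtain A B where "A \<union> B = verts (torus n k)" and AB: "A \<inter> B = {}"
    and edges: "\<forall>e\<in>edges (torus n k). \<exists>a\<in>A. \<exists>b\<in>B. e = {a, b}"
    using bip unfolding bipartite_def by (elim exE conjE)
  \<comment> \<open>A walk round the cycle through the origin. Time \<open>t\<close> is unbounded,
    so the induction below has no separate wrap-around case.\<close>
  define c where "c t = (\<lambda>j\<in>{1..n}. if j = i then t mod k i else 0)" for t
  have k0: "\<forall>i\<in>{1..n}. k i > 0"
    using k by force
  have c_vert: "c t \<in> torus_verts n k" for t
    using k0 unfolding torus_verts_iff[OF k0] by (auto simp: c_def)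
  \<comment> \<open>The parity of the current coordinate is the colour that steps forward.\<close>
  have step: "c (Suc t) = torus_mate k (i, even (c t i)) (c t)" for t
    using i by (auto simp: c_def torus_mate_def mod_simps)
  have "{c t, c (Suc t)} \<in> edges (torus n k)" for t
    unfolding step[of t]
    by (subst torus_edges_eq[OF k]) (use c_vert[of t] i in blast)+
  then have flip: "c (Suc t) \<in> A \<longleftrightarrow> c t \<notin> A" for t
    using bspec[OF edges, of "{c t, c (Suc t)}"] AB by (auto simp: doubleton_eq_iff)
  have "c t \<in> A \<longleftrightarrow> (even t \<longleftrightarrow> c 0 \<in> A)" for t
    by (induction t) (auto simp: flip)
  \<comment> \<open>Taking \<open>t = k i\<close> above, the walk is back on its initial side, which
    forces \<open>k i\<close> to be even.\<close>
  moreover have "c (k i) = c 0" by (simp only: c_def mod_self mod_0)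
  ultimately show ?thesis by metis
qed

theorem theorem4p8:
  fixes n :: nat and k :: "nat \<Rightarrow> nat"
  assumes "n \<ge> 2"
    and "\<And>i. i \<in> {1..n} \<Longrightarrow> k i \<ge> 3"
    and "bipartite (torus n k)"
  shows "fmp (torus n k) = enat (2 * n) \<and> fsmp (torus n k) = 1"
proof -
  let ?C = "{1..n} \<times> (UNIV :: bool set)"
  have k0: "\<forall>i\<in>{1..n}. k i > 0"
    using assms(2) by force
  have verts: "verts (torus n k) = torus_verts n k" by (simp add: torus_def)
  \<comment> \<open>Bipartiteness enters here through the evenness of each \<open>k i\<close>, which
    gives the involution law.\<close>
  interpret one_factorization "torus n k" ?C "torus_mate k"
  proof
    show "torus_mate k c (torus_mate k c v) = v" if "c \<in> ?C" "v \<in> verts (torus n k)" for c v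
      using that torus_mate_mate bipartite_torus_even[OF assms(2,3)] k0
      by (auto simp: verts torus_verts_iff[OF k0])
  qed (use assms(2) torus_edges_eq inj_on_torus_mate in \<open>auto simp: verts\<close>)
  \<comment> \<open>The origin is the vertex to be isolated for \<open>fmp\<close> and deleted for
    \<open>fsmp\<close>.\<close>
  have v: "(\<lambda>j\<in>{1..n}. 0) \<in> verts (torus n k)"
    using k0 by (simp add: verts torus_verts_iff[OF k0])
  have "(1, True) \<in> ?C" using assms(1) by simp
  then have "fractional_perfect_matching (torus n k) (\<lambda>e. of_bool (e \<in> factor (1, True)))"
    using fractional_perfect_matching_factor[of "(1, True)" "{}"] by simp
  then have "fsmp (torus n k) = 1"
    using fsmp_bipartite assms(3) v by (metis verts finite_torus_verts)
  moreover have "fmp (torus n k) = enat (2 * n)"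
    using fmp_eq_card_colours[OF v] by (simp add: mult.commute)
  ultimately show ?thesis by simp
qed

end
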